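(* Let $d\ge 2$ and $D=\{0,1,\dots,d-1\}$. Let $x_1,x_2,\dots$ be any infinite sequence with values in $D$, let $Y_1,Y_2,\dots$ be the random predictions produced by the generalized Blackwell algorithm applied to this sequence, and let $v_n=\overline x_n+\overline\gamma_n\mathbf 1_d$. Then, with probability one, $\operatorname{dist}(v_n,\mathcal S_d)\to 0$ as $n\to\infty$.
   Context: Components of vectors in $\mathbb R^d$ are denoted by superindices, $v=(v^{(0)},\dots,v^{(d-1)})$; $e_0,\dots,e_{d-1}$ are the standard unit vectors of $\mathbb R^d$, $\mathbf 1_d=(1,\dots,1)$, $\langle\cdot,\cdot\rangle$ is the Euclidean scalar product and $\operatorname{dist}$ the Euclidean distance. For $a_0,\dots,a_n\in\mathbb R^d$, $A(\{a_0,\dots,a_n\})=\{\sum_i\lambda_i a_i : \lambda_i\in\mathbb R,\ \sum_i\lambda_i=1\}$ is the affine subspace they generate. Let $\Sigma_{d-1}=\{q\in\mathbb R^d: q^{(l)}\ge 0,\ \sum_{l=0}^{d-1}q^{(l)}=1\}$, $V_d=\{q+\gamma\mathbf 1_d: q\in\Sigma_{d-1},\ 0\le\gamma\le 1\}$ (the pair $(q,\gamma)$ is uniquely determined by $q+\gamma\mathbf 1_d$), and $\mathcal S_d=\{q+\gamma\mathbf 1_d\in V_d:\gamma\ge\max_l q^{(l)}\}$. Put $s=\frac2d\mathbf 1_d$ and, for $l\in D$, $n_l=-e_l+\frac2d\mathbf 1_d$ and $E_l=A(\{e_k: k\ne l\}\cup\{e_l+\mathbf 1_d\})=\{x\in\mathbb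 R^d:\langle x-s,n_l\rangle=0\}$. Outcomes and predictions: for $n\ge1$, $\overline x_n=(\overline x_n^{(0)},\dots,\overline x_n^{(d-1)})$ with $\overline x_n^{(l)}=\frac1n\sum_{k=1}^n 1_{\{x_k=l\}}$ is the vector of relative frequencies of the outcomes, and $\overline\gamma_n=\frac1n\sum_{k=1}^n1_{\{Y_k=x_k\}}$ is the relative frequency of correct predictions. Thus $v_n=\overline x_n+\overline\gamma_n\mathbf 1_d\in V_d$. Randomisation vector $p(v)\in\Sigma_{d-1}$: Case 1: $v\in V_d\setminus\mathcal S_d$. Let $(i_0,\dots,i_{d-1})$ be a permutation of $(0,\dots,d-1)$ and $0\le j\le d-1$ such that $\langle v-s,n_l\rangle\le 0$ for $l=i_0,\dots,i_j$ and $\langle v-s,n_l\rangle>0$ for $l=i_{j+1},\dots,i_{d-1}$. Let $A_1=A(\{\frac2d\mathbf 1_d,e_{i_{j+1}},\dots,e_{i_{d-1}},v\})$ and $A_2=A(\{e_{i_0},\dots,e_{i_j}\})$. The intersection $A_1\cap A_2$ contains exactly one point of $\Sigma_{d-1}$; this point is $p(v)$. Case 2: $v=q+\gamma\mathbf 1_d\in\partial\mathcal S_d$, meaning $v\in V_d$ with $\gamma=\max_l q^{(l)}$. Let $\nu=\#\{k\in D: v\in E_k\}$ (so $\nu\ge1$). Then $p^{(k)}(v)=1/\nu$ if $v\in E_k$ and $p^{(k)}(v)=0$ if $v\notin E_k$. The generalized Blackwell algorithm: $Y_1$ is an arbitrary $D$-valued prediction; for $n\ge 1$, conditionally on the past ($Y_1,\dots,Y_n$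 and $x_1,\dots,x_n$), $Y_{n+1}$ takes the value $k$ with probability $p^{(k)}(v_n)$, $k\in D$. (No rule is specified for $v_n=q+\gamma\mathbf 1_d$ with $\gamma>\max_l q^{(l)}$; by the construction of the rule this case does not occur.) *)

theory Defs
  imports "HOL-Probability.Probability"
begin

text \<open>
  The outcome set D is a finite type \<^typ>\<open>'d\<close>, so that d is \<^term>\<open>CARD('d)\<close> and vectors of
  R^d have type \<^typ>\<open>real^'d\<close>. Outcomes and predictions are sequences indexed from 1;
  their values at index 0 are never used.
\<close>

definition std_simplex :: "(real^'d::finite) set" where
  "std_simplex = {q. (\<forall>l. 0 \<le> q $ l) \<and> (\<Sum>l\<in>UNIV. q $ l) = 1}"

definition V_set :: "(real^'d::finite) set" where
  "V_set = {q + \<gamma> *\<^sub>R vec 1 | q \<gamma>. q \<in> std_simplex \<and> 0 \<le> \<gamma> \<and> \<gamma> \<le> 1}"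

definition S_set :: "(real^'d::finite) set" where
  "S_set = {q + \<gamma> *\<^sub>R vec 1 | q \<gamma>. q \<in> std_simplex \<and> 0 \<le> \<gamma> \<and> \<gamma> \<le> 1 \<and>
              \<gamma> \<ge> Max (range (\<lambda>l. q $ l))}"

text \<open>The part of the boundary of \<^term>\<open>S_set\<close> on which \<open>\<gamma> = max q\<close>; this is not the
  topological frontier (points of \<^term>\<open>S_set\<close> with \<open>\<gamma> = 1\<close> are excluded unless \<open>max q = 1\<close>).\<close>

definition bdS_set :: "(real^'d::finite) set" where
  "bdS_set = {q + \<gamma> *\<^sub>R vec 1 | q \<gamma>. q \<in> std_simplex \<and> 0 \<le> \<gamma> \<and> \<gamma> \<le> 1 \<and>
              \<gamma> = Max (range (\<lambda>l. q $ l))}"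

definition s_pt :: "real^'d::finite" where
  "s_pt = (2 / real CARD('d)) *\<^sub>R vec 1"

definition n_vec :: "'d \<Rightarrow> real^'d::finite" where
  "n_vec l = - axis l 1 + (2 / real CARD('d)) *\<^sub>R vec 1"

definition E_plane :: "'d \<Rightarrow> (real^'d::finite) set" where
  "E_plane l = affine hull ({axis k 1 | k. k \<noteq> l} \<union> {axis l 1 + vec 1})"

text \<open>The index sets \<open>{i\<^sub>0, \<dots>, i\<^sub>j}\<close> and \<open>{i\<^sub>j\<^sub>+\<^sub>1, \<dots>, i\<^sub>d\<^sub>-\<^sub>1}\<close> of the permutation are the
  sets of \<open>l\<close> with \<open>\<langle>v - s, n\<^sub>l\<rangle> \<le> 0\<close> and \<open>\<langle>v - s, n\<^sub>l\<rangle> > 0\<close>.\<close>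

definition A1_space :: "real^'d::finite \<Rightarrow> (real^'d) set" where
  "A1_space v = affine hull ({s_pt} \<union> {axis l 1 | l. (v - s_pt) \<bullet> n_vec l > 0} \<union> {v})"

definition A2_space :: "real^'d::finite \<Rightarrow> (real^'d) set" where
  "A2_space v = affine hull {axis l 1 | l. (v - s_pt) \<bullet> n_vec l \<le> 0}"

definition rand_vec :: "real^'d::finite \<Rightarrow> real^'d" where
  "rand_vec v =
     (if v \<in> V_set - S_set then THE p. p \<in> A1_space v \<inter> A2_space v \<inter> std_simplex
      else if v \<in> bdS_set then
        (\<chi> k. if v \<in> E_plane k then 1 / real (card {l. v \<in> E_plane l}) else 0)
      else undefined)"

definition outcome_freq :: "(nat \<Rightarrow> 'd) \<Rightarrow> nat \<Rightarrow> real^'d::finite" where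
  "outcome_freq x n = (\<chi> l. (1 / real n) * (\<Sum>k=1..n. if x k = l then 1 else 0))"

definition success_freq :: "(nat \<Rightarrow> 'd) \<Rightarrow> (nat \<Rightarrow> 'd) \<Rightarrow> nat \<Rightarrow> real" where
  "success_freq x y n = (1 / real n) * (\<Sum>k=1..n. if y k = x k then 1 else 0)"

definition v_pt :: "(nat \<Rightarrow> 'd) \<Rightarrow> (nat \<Rightarrow> 'd) \<Rightarrow> nat \<Rightarrow> real^'d::finite" where
  "v_pt x y n = outcome_freq x n + success_freq x y n *\<^sub>R vec 1"

text \<open>\<open>Y\<close> is a prediction process generated by the algorithm from the outcome sequence \<open>x\<close>.
  As \<open>x\<close> is deterministic and \<open>D\<close> is finite, conditioning on the past means conditioning on the
  events \<open>Y\<^sub>1 = y\<^sub>1, \<dots>, Y\<^sub>n = y\<^sub>n\<close> of positive probability. Nothing is required of the law of \<open>Y\<^sub>1\<close>,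
  nor of the next prediction after a past for which \<open>\<gamma> > max q\<close>, where no rule is specified.\<close>

definition gen_Blackwell :: "'w measure \<Rightarrow> (nat \<Rightarrow> 'd::finite) \<Rightarrow> (nat \<Rightarrow> 'w \<Rightarrow> 'd) \<Rightarrow> bool" where
  "gen_Blackwell M x Y \<longleftrightarrow>
     (\<forall>n\<ge>1. Y n \<in> M \<rightarrow>\<^sub>M count_space UNIV) \<and>
     (\<forall>n\<ge>1. \<forall>y k.
        \<P>(\<omega> in M. \<forall>i\<in>{1..n}. Y i \<omega> = y i) > 0 \<longrightarrow>
        v_pt x y n \<in> (V_set - S_set) \<union> bdS_set \<longrightarrow>
        \<P>(\<omega> in M. Y (Suc n) \<omega> = k \<bar> \<forall>i\<in>{1..n}. Y i \<omega> = y i) = rand_vec (v_pt x y n) $ k)"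

end

theory Submission
  imports Defs "HOL-Library.Discrete_Functions"
begin

text \<open>
  Write \<open>v\<^sub>n = q + \<gamma> 1\<close> and \<open>R\<^sub>n(l) = n (q\<^sub>l - \<gamma>)\<close>, the regret for not always having predicted \<open>l\<close>.
  Since \<open>\<langle>v - s, n\<^sub>l\<rangle> = \<gamma> - q\<^sub>l\<close>, outside \<^term>\<open>S_set\<close> the randomisation vector is proportional to the
  vector of positive parts \<open>(q\<^sub>l - \<gamma>)\<^sup>+\<close>. This makes the increment of \<open>R\<^sub>n\<close> orthogonal to
  \<open>R\<^sub>n\<^sup>+\<close> in conditional mean, whatever the next outcome is, so \<open>\<Sum>\<^sub>l (R\<^sub>n\<^sup>+(l))\<^sup>2\<close> grows at most
  linearly in mean. Hence \<open>R\<^sub>n\<^sup>+ / n \<longlonglongrightarrow> 0\<close> almost surely along the squares, by summability, and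
  then along all \<open>n\<close>, because the regret increases by at most 1 per step. On \<^term>\<open>S_set\<close> the
  vector \<open>R\<^sub>n\<^sup>+\<close> vanishes, so the rule used there is irrelevant.
\<close>

section \<open>Regret and relative frequencies\<close>

definition regret :: "(nat \<Rightarrow> 'd) \<Rightarrow> (nat \<Rightarrow> 'd) \<Rightarrow> nat \<Rightarrow> 'd \<Rightarrow> real" where
  "regret x y n l = (\<Sum>k=1..n. (if x k = l then 1 else 0) - (if y k = x k then 1 else 0))"

lemma regret_0 [simp]: "regret x y 0 l = 0"
  by (simp add: regret_def)

lemma regret_Suc:
  "regret x y (Suc n) l =
     regret x y n l + ((if x (Suc n) = l then 1 else 0) - (if y (Suc n) = x (Suc n) then 1 else 0))"
  by (simp add: regret_def)

lemma regret_cong: "(\<And>i. i \<in> {1..n} \<Longrightarrow> y i = z i) \<Longrightarrow> regret x y n l = regret x z n l"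
  unfolding regret_def by (intro sum.cong) auto

lemma abs_regret_le: "\<bar>regret x y n l\<bar> \<le> real n"
proof (induction n)
  case (Suc n)
  then show ?case by (auto simp: regret_Suc)
qed simp

text \<open>Links the cumulative regret to the geometry of \<open>v_pt\<close>. At
  \<open>n = 0\<close> both sides are 0, because division by zero yields 0.\<close>

lemma outcome_freq_minus_success_freq:
  "outcome_freq x n $ l - success_freq x y n = regret x y n l / real n"
  by (simp add: outcome_freq_def success_freq_def regret_def sum_subtractf diff_divide_distrib)

lemma outcome_freq_in_simplex:
  fixes x :: "nat \<Rightarrow> 'd::finite"
  assumes "n \<ge> 1"
  shows "outcome_freq x n \<in> std_simplex"
proof -
  \<comment> \<open>Double counting: each index \<open>k\<close> contributes to exactly one
    \<open>l\<close>.\<close>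
  have "(\<Sum>l\<in>UNIV. \<Sum>k=1..n. if x k = l then 1 else 0) = (\<Sum>k=1..n. \<Sum>l\<in>(UNIV::'d set). if x k = l then 1 else (0::real))"
    by (rule sum.swap)
  then have "(\<Sum>l\<in>UNIV. \<Sum>k=1..n. if x k = l then 1 else 0) = real n"
    by simp
  then show ?thesis
    using assms by (auto simp: std_simplex_def outcome_freq_def sum_nonneg simp flip: sum_divide_distrib)
qed

lemma success_freq_bounds: "0 \<le> success_freq x y n" "success_freq x y n \<le> 1"
proof -
  have "(\<Sum>k=1..n. if y k = x k then 1 else 0) \<le> (\<Sum>k=1..n. (1::real))"
    by (intro sum_mono) auto
  then have "(\<Sum>k=1..n. if y k = x k then 1 else 0) \<le> real n"
    by simp
  then show "success_freq x y n \<le> 1"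
    by (cases "n = 0") (auto simp: success_freq_def field_simps)
  show "0 \<le> success_freq x y n"
    by (auto simp: success_freq_def sum_nonneg)
qed

section \<open>Affine functionals locating a point relative to \<open>S_set\<close>\<close>

text \<open>The affine function \<open>z \<mapsto> z\<^sub>l - 2 (\<Sigma> z - 1) / d\<close> takes the value \<open>q\<^sub>l - \<gamma>\<close> at \<open>q + \<gamma> 1\<close>.\<close>

definition excess :: "real^'d::finite \<Rightarrow> 'd \<Rightarrow> real" where
  "excess z l = z $ l - 2 * ((\<Sum>k\<in>UNIV. z $ k) - 1) / real CARD('d)"

lemma excess_decomp:
  fixes q :: "real^'d::finite"
  assumes "q \<in> std_simplex"
  shows "excess (q + g *\<^sub>R vec 1) l = q $ l - g"
  using assms by (simp add: excess_def std_simplex_def sum.distrib)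

lemma excess_affine:
  assumes "u + v = 1"
  shows "excess (u *\<^sub>R a + v *\<^sub>R b) l = u * excess a l + v * excess b l"
proof -
  have v: "v = 1 - u" using assms by simp
  have "(\<Sum>k\<in>UNIV. (u *\<^sub>R a + v *\<^sub>R b) $ k) = u * (\<Sum>k\<in>UNIV. a $ k) + v * (\<Sum>k\<in>UNIV. b $ k)"
    by (simp add: sum.distrib sum_distrib_left)
  then show ?thesis
    unfolding excess_def
    by (simp only:) (simp add: v field_simps)
qed

text \<open>Turns the index sets of \<open>A1_space\<close> and \<open>A2_space\<close> into the
  coordinates of negative and of nonnegative excess, respectively.\<close>

lemma inner_n_vec: "(v - s_pt) \<bullet> n_vec l = - excess v l"
proof -
  have *: "a \<bullet> n_vec l = - a $ l + 2 / real CARD('a) * (\<Sum>k\<in>UNIV. a $ k)" for a :: "real^'a::finite" and l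
  proof -
    have "a \<bullet> vec 1 = (\<Sum>k\<in>UNIV. a $ k)"
      by (simp add: inner_vec_def)
    then show ?thesis
      by (simp add: n_vec_def inner_add_right inner_diff_right inner_axis del: vec_1)
  qed
  show ?thesis
    unfolding * by (simp add: s_pt_def excess_def sum_subtractf diff_divide_distrib right_diff_distrib)
qed

text \<open>Used contrapositively: one positive excess puts a point outside \<open>S_set\<close>. As
  \<open>excess\<close> depends on the point alone, no two decompositions into \<open>q\<close> and
  \<open>g\<close> have to be compared.\<close>

lemma S_set_excess:
  assumes "v \<in> S_set"
  shows "excess v l \<le> 0"
proof -
  obtain q g where v: "v = q + g *\<^sub>R vec 1" "q \<in> std_simplex" "g \<ge> Max (range (\<lambda>l. q $ l))"
    using assms by (auto simp: S_set_def)
  have "q $ l \<le> Max (range (\<lambda>l. q $ l))"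
    by (intro Max_ge) auto
  with v show ?thesis
    by (simp add: excess_decomp del: vec_1)
qed

section \<open>The randomisation vector outside \<open>S_set\<close>\<close>

text \<open>The property survives affine combinations, so the generators decide:
  \<open>m = 0\<close> for \<open>s_pt\<close>, whose excess vanishes, and for
  \<open>axis l 1\<close> with \<open>excess v l < 0\<close>, whose excess is concentrated at
  \<open>l\<close>; \<open>m = 1\<close> for \<open>v\<close>. This gives the nonnegative-excess
  half of uniqueness in Case 1.\<close>

lemma A1_excess:
  fixes v :: "real^'d::finite"
  assumes "z \<in> A1_space v"
  shows "\<exists>m. \<forall>l. excess v l \<ge> 0 \<longrightarrow> excess z l = m * excess v l"
proof -
  define T where "T = {z. \<exists>m. \<forall>l. excess v l \<ge> 0 \<longrightarrow> excess z l = m * excess v l}"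
  have "affine T"
    unfolding affine_def
  proof (intro ballI allI impI)
    fix a b and s t :: real
    assume "a \<in> T" "b \<in> T" and st: "s + t = 1"
    then obtain m m' where
      "\<forall>l. excess v l \<ge> 0 \<longrightarrow> excess a l = m * excess v l"
      "\<forall>l. excess v l \<ge> 0 \<longrightarrow> excess b l = m' * excess v l"
      by (auto simp: T_def)
    then have "\<forall>l. excess v l \<ge> 0 \<longrightarrow> excess (s *\<^sub>R a + t *\<^sub>R b) l = (s * m + t * m') * excess v l"
      by (auto simp: excess_affine[OF st] algebra_simps)
    then show "s *\<^sub>R a + t *\<^sub>R b \<in> T"
      by (auto simp: T_def)
  qed
  have "excess (s_pt :: real^'d) l = 0" for l
    by (simp add: excess_def s_pt_def)
  then have "s_pt \<in> T"
    by (auto simp: T_def intro!: exI[of _ 0])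
  moreover have "axis l 1 \<in> T" if "excess v l < 0" for l
  proof -
    have "excess (axis l 1) k = 0" if "excess v k \<ge> 0" for k
      using that \<open>excess v l < 0\<close> by (auto simp: excess_def axis_def)
    then show ?thesis
      by (auto simp: T_def intro!: exI[of _ 0])
  qed
  moreover have "v \<in> T"
    by (auto simp: T_def intro!: exI[of _ 1])
  ultimately have "affine hull ({s_pt} \<union> {axis l 1 | l. (v - s_pt) \<bullet> n_vec l > 0} \<union> {v}) \<subseteq> T"
    by (intro hull_minimal \<open>affine T\<close>) (auto simp: inner_n_vec)
  with assms show ?thesis
    by (auto simp: A1_space_def T_def)
qed

text \<open>The complementary half of uniqueness: every generator of \<open>A2_space v\<close>
  vanishes at \<open>k\<close>, and so does every affine combination.\<close>

lemma A2_zero: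
  fixes v :: "real^'d::finite"
  assumes "z \<in> A2_space v" "excess v k < 0"
  shows "z $ k = 0"
proof -
  have "affine {z :: real^'d. z $ k = 0}"
    by (auto simp: affine_def)
  then have "affine hull {axis l (1::real) | l. (v - s_pt) \<bullet> n_vec l \<le> 0} \<subseteq> {z. z $ k = 0}"
    using assms(2) by (intro hull_minimal) (auto simp: inner_n_vec axis_def)
  with assms(1) show ?thesis
    by (auto simp: A2_space_def)
qed

text \<open>Spanning by differences avoids having to know that the generators are distinct.\<close>

lemma affine_hull_diffs:
  assumes "a \<in> A" "z - a \<in> span ((\<lambda>b. b - a) ` A)"
  shows "z \<in> affine hull A"
proof -
  have "span ((\<lambda>b. b - a) ` A) \<subseteq> (\<lambda>b. b - a) ` (affine hull A)"
  proof (rule span_minimal)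
    show "(\<lambda>b. b - a) ` A \<subseteq> (\<lambda>b. b - a) ` (affine hull A)"
      using hull_subset by fast
    have "subspace ((+) (- a) ` (affine hull A))"
      using assms(1) by (intro affine_diffs_subspace) (auto intro: hull_inc)
    then show "subspace ((\<lambda>b. b - a) ` (affine hull A))"
      by (simp add: image_def)
  qed
  with assms(2) show ?thesis
    by auto
qed

text \<open>Existence: the normalised vector of positive parts is written as an affine combination
  of either set of generators. Uniqueness: \<open>A1_excess\<close> and \<open>A2_zero\<close>
  determine the point up to the factor \<open>m\<close>, which the coordinate sum 1 then
  fixes.\<close>

lemma rand_vec_outside:
  fixes q :: "real^'d::finite"
  assumes q: "q \<in> std_simplex" and g: "0 \<le> g" "g \<le> 1" and out: "g < q $ j"
  shows "rand_vec (q + g *\<^sub>R vec 1) $ k = max 0 (q $ k - g) / (\<Sum>l\<in>UNIV. max 0 (q $ l - g))"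
proof -
  define v where "v = q + g *\<^sub>R vec 1"
  define t where "t = (\<Sum>l\<in>UNIV. max 0 (q $ l - g))"
  define p where "p = (\<chi> l. max 0 (q $ l - g) / t)"
  have ex: "excess v l = q $ l - g" for l
    using q by (simp add: v_def excess_decomp del: vec_1)
  have "0 < max 0 (q $ j - g)" using out by simp
  also have "\<dots> \<le> t"
    unfolding t_def by (intro member_le_sum) auto
  finally have t: "t > 0" .
  have "v \<in> V_set"
    using q g by (auto simp: V_set_def v_def)
  moreover have "v \<notin> S_set"
    using S_set_excess[of v j] out by (auto simp: ex)
  ultimately have rand: "rand_vec v = (THE p. p \<in> A1_space v \<inter> A2_space v \<inter> std_simplex)"
    by (simp add: rand_vec_def)
  have p_simplex: "p \<in> std_simplex"
    using t by (auto simp: std_simplex_def p_def simp flip: sum_divide_distrib t_def)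
  have p_expand: "p = (\<Sum>l\<in>UNIV. (p $ l) *\<^sub>R axis l 1)"
    by (simp add: vec_eq_iff axis_def if_distrib[of "\<lambda>x. _ * x"] cong: if_cong)
  have p_zero: "p $ l = 0" if "excess v l < 0" for l
    using that by (simp add: p_def ex)
  have p_A2: "p \<in> A2_space v"
  proof -
    define B where "B = {axis l (1::real) | l. (v - s_pt) \<bullet> n_vec l \<le> 0}"
    have a: "axis j 1 \<in> B"
      using out by (auto simp: B_def inner_n_vec ex intro!: exI[of _ j])
    \<comment> \<open>The coordinates of \<open>p\<close> sum to 1, so \<open>axis j 1\<close> can
      be subtracted inside the combination. It serves as base point because \<open>j\<close> has
      positive excess.\<close>
    have "p - axis j 1 = (\<Sum>l\<in>UNIV. (p $ l) *\<^sub>R axis l 1) - (\<Sum>l\<in>UNIV. p $ l) *\<^sub>R axis j 1"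
      using p_simplex by (subst p_expand) (auto simp: std_simplex_def)
    also have "\<dots> = (\<Sum>l\<in>UNIV. (p $ l) *\<^sub>R (axis l 1 - axis j 1))"
      by (simp add: scaleR_diff_right sum_subtractf scaleR_sum_left)
    also have "\<dots> \<in> span ((\<lambda>b. b - axis j 1) ` B)"
    proof (intro span_sum)
      fix l
      show "(p $ l) *\<^sub>R (axis l 1 - axis j 1) \<in> span ((\<lambda>b. b - axis j 1) ` B)"
      proof (cases "excess v l < 0")
        case True
        then show ?thesis by (simp add: p_zero span_zero)
      next
        case False
        then have "axis l 1 \<in> B" by (auto simp: B_def inner_n_vec)
        then show ?thesis by (intro span_scale span_base) auto
      qed
    qed
    finally show ?thesis
      unfolding A2_space_def B_def[symmetric] by (rule affine_hull_diffs[OF a])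
  qed
  have p_A1: "p \<in> A1_space v"
  proof -
    define B where "B = {s_pt} \<union> {axis l (1::real) | l. (v - s_pt) \<bullet> n_vec l > 0} \<union> {v}"
    \<comment> \<open>The coefficients are found by comparing excesses: that of \<open>p\<close> is
      \<open>p\<close> itself, that of \<open>s_pt\<close> is 0 and that of \<open>axis l 1\<close>
      is the \<open>l\<close>-th unit vector. Hence \<open>v\<close> gets weight
      \<open>1 / t\<close>, and \<open>axis l 1\<close> cancels what is negative in
      \<open>(q $ l - g) / t\<close>.\<close>
    have p_eq: "p - s_pt = (1 / t) *\<^sub>R (v - s_pt)
        + (\<Sum>l\<in>UNIV. (max 0 (g - q $ l) / t) *\<^sub>R (axis l 1 - s_pt))"
    proof -
      have sq: "(\<Sum>l\<in>UNIV. q $ l) = 1" using q by (simp add: std_simplex_def)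
      have "(\<Sum>l\<in>UNIV. max 0 (g - q $ l)) = (\<Sum>l\<in>UNIV. max 0 (q $ l - g) - q $ l + g)"
        by (intro sum.cong) (auto simp: max_def)
      also have "\<dots> = t - 1 + real CARD('d) * g"
        by (simp add: sum.distrib sum_subtractf t_def sq)
      finally have sm: "(\<Sum>l\<in>UNIV. max 0 (g - q $ l)) = t - 1 + real CARD('d) * g" .
      show ?thesis
      proof (subst vec_eq_iff, intro allI)
        fix i
        have "(\<Sum>l\<in>UNIV. (max 0 (g - q $ l) / t) * (axis l 1 $ i - 2 / real CARD('d)))
          = (\<Sum>l\<in>UNIV. (max 0 (g - q $ l) / t) * axis l 1 $ i) - (\<Sum>l\<in>UNIV. max 0 (g - q $ l)) / t * (2 / real CARD('d))"
          by (simp add: right_diff_distrib sum_subtractf sum_divide_distrib sum_distrib_right)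
        also have "(\<Sum>l\<in>UNIV. (max 0 (g - q $ l) / t) * axis l 1 $ i) = max 0 (g - q $ i) / t"
          by (simp add: axis_def if_distrib[of "\<lambda>x. _ * x"] cong: if_cong)
        finally have s: "(\<Sum>l\<in>UNIV. (max 0 (g - q $ l) / t) * (axis l 1 $ i - 2 / real CARD('d)))
          = max 0 (g - q $ i) / t - (t - 1 + real CARD('d) * g) / t * (2 / real CARD('d))"
          by (simp only: sm)
        have m: "max 0 (g - q $ i) = max 0 (q $ i - g) - q $ i + g" by auto
        show "(p - s_pt) $ i = ((1 / t) *\<^sub>R (v - s_pt)
          + (\<Sum>l\<in>UNIV. (max 0 (g - q $ l) / t) *\<^sub>R (axis l 1 - s_pt))) $ i"
        proof -
          have "((1 / t) *\<^sub>R (v - s_pt)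
            + (\<Sum>l\<in>UNIV. (max 0 (g - q $ l) / t) *\<^sub>R (axis l 1 - s_pt))) $ i
            = (1 / t) * (q $ i + g - 2 / real CARD('d))
            + (\<Sum>l\<in>UNIV. (max 0 (g - q $ l) / t) * (axis l 1 $ i - 2 / real CARD('d)))"
            by (simp only: v_def s_pt_def vector_add_component vector_minus_component
                vector_scaleR_component sum_component vec_component real_scaleR_def mult_1_right)
          also have "\<dots> = max 0 (q $ i - g) / t - 2 / real CARD('d)"
            unfolding s m using t by (simp add: diff_divide_distrib add_divide_distrib left_diff_distrib distrib_right)
          also have "\<dots> = (p - s_pt) $ i"
            by (simp add: p_def s_pt_def)
          finally show ?thesis by (rule sym)
        qed
      qed
    qed
    also have "\<dots> \<in> span ((\<lambda>b. b - s_pt) ` B)"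
    proof (intro span_add span_sum)
      show "(1 / t) *\<^sub>R (v - s_pt) \<in> span ((\<lambda>b. b - s_pt) ` B)"
        by (intro span_scale span_base) (auto simp: B_def)
      fix l
      show "(max 0 (g - q $ l) / t) *\<^sub>R (axis l 1 - s_pt) \<in> span ((\<lambda>b. b - s_pt) ` B)"
      proof (cases "excess v l < 0")
        case True
        then have "axis l 1 \<in> B" by (auto simp: B_def inner_n_vec)
        then show ?thesis by (intro span_scale span_base) auto
      next
        case False
        then show ?thesis by (simp add: ex max_def span_zero)
      qed
    qed
    finally show ?thesis
      unfolding A1_space_def B_def[symmetric] by (rule affine_hull_diffs[rotated]) (simp add: B_def)
  qed
  have uniq: "z = p" if z: "z \<in> A1_space v" "z \<in> A2_space v" "z \<in> std_simplex" for z
  proof -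
    obtain m where m: "\<And>l. q $ l - g \<ge> 0 \<Longrightarrow> excess z l = m * (q $ l - g)"
      using A1_excess[OF z(1)] by (auto simp: ex)
    \<comment> \<open>A point of the simplex is its own decomposition with
      \<open>g = 0\<close>.\<close>
    have "excess z l = z $ l" for l
      using excess_decomp[OF z(3), of 0] by simp
    then have zl: "z $ l = m * max 0 (q $ l - g)" for l
      using m[of l] A2_zero[OF z(2), of l] by (cases "q $ l - g \<ge> 0") (auto simp: ex)
    have "1 = (\<Sum>l\<in>UNIV. m * max 0 (q $ l - g))"
      using z(3) by (simp add: std_simplex_def flip: zl)
    then have "m * t = 1"
      by (simp add: t_def sum_distrib_left)
    then have "m = 1 / t"
      using t by (simp add: field_simps)
    then show ?thesis
      by (simp add: vec_eq_iff zl p_def)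
  qed
  have "rand_vec v = p"
    unfolding rand
  proof (rule the_equality)
    show "p \<in> A1_space v \<inter> A2_space v \<inter> std_simplex"
      using p_A1 p_A2 p_simplex by blast
    show "z = p" if "z \<in> A1_space v \<inter> A2_space v \<inter> std_simplex" for z
      using that by (intro uniq) blast+
  qed
  then show ?thesis
    by (simp add: p_def t_def v_def)
qed

section \<open>Distance to \<open>S_set\<close> in terms of positive regret\<close>

text \<open>The comparison point keeps \<open>q\<close> and raises \<open>g\<close> just to the
  largest coordinate of \<open>q\<close>, if it lies below it.\<close>

lemma infdist_S_set_le:
  fixes q :: "real^'d::finite"
  assumes q: "q \<in> std_simplex" and g: "0 \<le> g" "g \<le> 1"
  shows "infdist (q + g *\<^sub>R vec 1) S_set \<le> (\<Sum>l\<in>UNIV. max 0 (q $ l - g)) * norm (vec 1 :: real^'d)"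
proof -
  define h where "h = max g (Max (range (\<lambda>l. q $ l)))"
  have "Max (range (\<lambda>l. q $ l)) \<in> range (\<lambda>l. q $ l)"
    by (intro Max_in) auto
  then obtain j where j: "Max (range (\<lambda>l. q $ l)) = q $ j" by blast
  \<comment> \<open>Keeps the raised level \<open>h\<close> at most 1.\<close>
  have "q $ j \<le> (\<Sum>l\<in>UNIV. q $ l)"
    using q by (intro member_le_sum) (auto simp: std_simplex_def)
  then have "q $ j \<le> 1" using q by (simp add: std_simplex_def)
  then have "q + h *\<^sub>R vec 1 \<in> S_set"
    using q g unfolding S_set_def h_def j[symmetric] by fastforce
  then have "infdist (q + g *\<^sub>R vec 1) S_set \<le> dist (q + g *\<^sub>R vec 1) (q + h *\<^sub>R vec 1)"
    by (rule infdist_le)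
  also have "\<dots> = max 0 (q $ j - g) * norm (vec 1 :: real^'d)"
    by (auto simp: dist_norm h_def j max_def simp flip: scaleR_diff_left)
  also have "\<dots> \<le> (\<Sum>l\<in>UNIV. max 0 (q $ l - g)) * norm (vec 1 :: real^'d)"
    by (intro mult_right_mono member_le_sum) auto
  finally show ?thesis .
qed

lemma infdist_v_pt_le:
  fixes x :: "nat \<Rightarrow> 'd::finite"
  assumes "n \<ge> 1"
  shows "infdist (v_pt x y n) S_set \<le> (\<Sum>l\<in>UNIV. max 0 (regret x y n l) / real n) * norm (vec 1 :: real^'d)"
proof -
  have "max 0 (regret x y n l / real n) = max 0 (regret x y n l) / real n" for l
    using assms by (auto simp: max_def divide_le_0_iff zero_le_divide_iff)
  then show ?thesis
    using infdist_S_set_le[OF outcome_freq_in_simplex[OF assms] success_freq_bounds, of x x y n]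
    by (simp add: v_pt_def outcome_freq_minus_success_freq)
qed

section \<open>Quadratic potential and its drift\<close>

text \<open>The squared Euclidean distance of the regret vector from the nonpositive
  orthant.\<close>

definition potential :: "(nat \<Rightarrow> 'd::finite) \<Rightarrow> (nat \<Rightarrow> 'd) \<Rightarrow> nat \<Rightarrow> real" where
  "potential x y n = (\<Sum>l\<in>UNIV. (max 0 (regret x y n l))\<^sup>2)"

text \<open>The inner product of the positive part of the regret at time \<open>n\<close> with the
  next regret increment, the sum over the outcome indicator already evaluated.\<close>

definition drift :: "(nat \<Rightarrow> 'd::finite) \<Rightarrow> (nat \<Rightarrow> 'd) \<Rightarrow> nat \<Rightarrow> real" where
  "drift x y n = max 0 (regret x y n (x (Suc n)))
     - (if y (Suc n) = x (Suc n) then 1 else 0) * (\<Sum>l\<in>UNIV. max 0 (regret x y n l))"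

lemma potential_Suc_le:
  fixes x :: "nat \<Rightarrow> 'd::finite"
  shows "potential x y (Suc n) \<le> potential x y n + 2 * drift x y n + real CARD('d)"
proof -
  define c :: real where "c = (if y (Suc n) = x (Suc n) then 1 else 0)"
  define u where "u l = (if x (Suc n) = l then 1 else 0) - c" for l
  let ?r = "\<lambda>l. max 0 (regret x y n l)"
  have "(max 0 (regret x y (Suc n) l))\<^sup>2 \<le> (?r l)\<^sup>2 + 2 * (?r l * u l) + 1" for l
  proof -
    \<comment> \<open>A positive \<open>regret + u\<close> is at most \<open>?r l + u l\<close>,
      because \<open>?r l\<close> dominates the regret. Expanding the square leaves the cross term
      for the drift and a remainder of at most 1 per coordinate.\<close>
    have "(max 0 (regret x y n l + u l))\<^sup>2 \<le> (?r l + u l)\<^sup>2"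
    proof (cases "regret x y n l + u l \<le> 0")
      case False
      then show ?thesis by (intro power_mono) auto
    qed (simp add: max_def)
    moreover have "(u l)\<^sup>2 \<le> 1"
      by (auto simp: u_def c_def)
    moreover have "regret x y (Suc n) l = regret x y n l + u l"
      by (simp add: regret_Suc u_def c_def)
    ultimately show ?thesis
      by (simp add: power2_sum)
  qed
  then have "potential x y (Suc n) \<le> (\<Sum>l\<in>UNIV. (?r l)\<^sup>2 + 2 * (?r l * u l) + 1)"
    unfolding potential_def by (rule sum_mono)
  also have "\<dots> = potential x y n + 2 * (\<Sum>l\<in>UNIV. ?r l * u l) + real CARD('d)"
    by (simp add: sum.distrib potential_def sum_distrib_left)
  also have "(\<Sum>l\<in>UNIV. ?r l * u l) = drift x y n"
    by (simp add: u_def drift_def right_diff_distrib sum_subtractf if_distrib[of "\<lambda>x. _ * x"]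
        sum_distrib_right mult.commute c_def cong: if_cong)
  finally show ?thesis .
qed

section \<open>From the squares to all times\<close>

text \<open>With \<open>k = floor_sqrt n\<close> one has \<open>n \<le> k\<^sup>2 + 2 * k\<close>,
  so since the last square \<open>a\<close> has grown by at most \<open>2 * k\<close>, which is
  negligible against \<open>k\<^sup>2\<close>.\<close>

lemma interpolate_squares:
  fixes a :: "nat \<Rightarrow> real"
  assumes nonneg: "\<And>n. 0 \<le> a n" and step: "\<And>n. a (Suc n) \<le> a n + 1"
    and sq: "(\<lambda>k. a (k\<^sup>2) / (real k)\<^sup>2) \<longlonglongrightarrow> 0"
  shows "(\<lambda>n. a n / real n) \<longlonglongrightarrow> 0"
proof -
  have add: "a (m + i) \<le> a m + real i" for m i
  proof (induction i)
    case (Suc i)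
    then show ?case using step[of "m + i"] by simp
  qed simp
  have lim: "(\<lambda>k. a (k\<^sup>2) / (real k)\<^sup>2 + 2 / real k) \<longlonglongrightarrow> 0"
    using tendsto_add[OF sq lim_const_over_n[of 2]] by simp
  have "filterlim floor_sqrt at_top sequentially"
    unfolding filterlim_at_top
  proof
    fix K
    show "\<forall>\<^sub>F n in sequentially. K \<le> floor_sqrt n"
      using eventually_ge_at_top[of "K\<^sup>2"]
      by eventually_elim (metis floor_sqrt_inverse_power2 mono_floor_sqrt')
  qed
  from filterlim_compose[OF lim this]
  have up: "(\<lambda>n. a ((floor_sqrt n)\<^sup>2) / (real (floor_sqrt n))\<^sup>2 + 2 / real (floor_sqrt n)) \<longlonglongrightarrow> 0" .
  show ?thesis
  proof (rule tendsto_sandwich[OF _ _ tendsto_const up])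
    show "\<forall>\<^sub>F n in sequentially. 0 \<le> a n / real n"
      using nonneg by auto
    show "\<forall>\<^sub>F n in sequentially.
        a n / real n \<le> a ((floor_sqrt n)\<^sup>2) / (real (floor_sqrt n))\<^sup>2 + 2 / real (floor_sqrt n)"
      using eventually_ge_at_top[of 1]
    proof eventually_elim
      case (elim n)
      define k where "k = floor_sqrt n"
      have k: "k \<ge> 1" "k\<^sup>2 \<le> n"
        using elim by (auto simp: k_def Suc_le_eq)
      have "n < (Suc k)\<^sup>2"
        unfolding k_def by (rule Suc_floor_sqrt_power2_gt)
      then have "n \<le> k\<^sup>2 + 2 * k"
        by (simp add: power2_eq_square)
      then obtain i where i: "n = k\<^sup>2 + i" "i \<le> 2 * k"
        using k(2) by (metis add_le_cancel_left le_add_diff_inverse)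
      have "a n / real n \<le> (a (k\<^sup>2) + 2 * real k) / real n"
        using add[of "k\<^sup>2" i] i by (intro divide_right_mono) auto
      also have "\<dots> \<le> (a (k\<^sup>2) + 2 * real k) / (real k)\<^sup>2"
        using k nonneg[of "k\<^sup>2"] by (intro divide_left_mono mult_pos_pos) (use elim in \<open>auto simp flip: of_nat_power\<close>)
      also have "\<dots> = a (k\<^sup>2) / (real k)\<^sup>2 + 2 / real k"
        using k by (simp add: field_simps power2_eq_square)
      finally show ?case by (simp add: k_def)
    qed
  qed
qed

section \<open>Expected growth of the potential under the algorithm\<close>

context
  fixes M :: "'w measure" and x :: "nat \<Rightarrow> 'd::finite" and Y :: "nat \<Rightarrow> 'w \<Rightarrow> 'd"
  assumes M: "prob_space M" and alg: "gen_Blackwell M x Y"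
begin

interpretation prob_space M by (rule M)

lemma Y_measurable: "n \<ge> 1 \<Longrightarrow> Y n \<in> M \<rightarrow>\<^sub>M count_space UNIV"
  using alg by (auto simp: gen_Blackwell_def)

lemma Y_pred: "n \<ge> 1 \<Longrightarrow> Measurable.pred M (\<lambda>\<omega>. Y n \<omega> = k)"
  using Y_measurable[of n] by measurable

lemma regret_measurable: "(\<lambda>\<omega>. regret x (\<lambda>k. Y k \<omega>) n l) \<in> borel_measurable M"
  unfolding regret_def using Y_pred
  by (intro borel_measurable_sum borel_measurable_diff borel_measurable_const measurable_If) auto

lemma potential_measurable: "(\<lambda>\<omega>. potential x (\<lambda>k. Y k \<omega>) n) \<in> borel_measurable M"
  unfolding potential_def using regret_measurable by measurable

text \<open>Orthogonality in conditional mean on a single history, for any next outcome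
  \<open>k\<close>: given \<open>?H\<close>, the prediction \<open>k\<close> has probability
  proportional to the positive regret of \<open>k\<close>. Multiplying out the denominators lets the
  identity cover null histories and vanishing positive regret.\<close>

lemma history_drift:
  fixes y :: "nat \<Rightarrow> 'd"
  shows "prob {\<omega>\<in>space M. \<forall>i\<in>{1..n}. Y i \<omega> = y i} * max 0 (regret x y n k) =
    prob {\<omega>\<in>space M. Y (Suc n) \<omega> = k \<and> (\<forall>i\<in>{1..n}. Y i \<omega> = y i)} * (\<Sum>l\<in>UNIV. max 0 (regret x y n l))"
    (is "prob ?H * _ = prob ?HY * ?t")
proof (cases "\<exists>j. regret x y n j > 0")
  \<comment> \<open>This case contains \<open>n = 0\<close>, hence the arbitrary first prediction,
    and every history without positive regret; both sides are 0.\<close>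
  case False
  then have "max 0 (regret x y n l) = 0" for l
    by (auto simp: not_less max_def intro: antisym)
  then show ?thesis by simp
next
  case True
  then obtain j where j: "regret x y n j > 0" by auto
  then have n: "n \<ge> 1" by (cases n) auto
  have "0 < max 0 (regret x y n j)" using j by simp
  also have "\<dots> \<le> ?t" by (intro member_le_sum) auto
  finally have t: "?t > 0" .
  have H: "?H \<in> events"
    using Y_pred by (intro sets.sets_Collect_finite_All) auto
  have sub: "?HY \<subseteq> ?H" by auto
  show ?thesis
  proof (cases "prob ?H = 0")
    case True
    then have "prob ?HY = 0"
      using finite_measure_mono[OF sub H] measure_nonneg[of M ?HY] by linarith
    with True show ?thesis by simp
  next
    case False
    then have pos: "prob ?H > 0"
      by (simp add: zero_less_measure_iff)
    let ?q = "outcome_freq x n" and ?g = "success_freq x y n"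
    have diff: "?q $ l - ?g = regret x y n l / real n" for l
      by (rule outcome_freq_minus_success_freq)
    have out: "?g < ?q $ j"
      using diff[of j] divide_pos_pos[OF j, of "real n"] n by simp
    have q: "?q \<in> std_simplex"
      using n by (rule outcome_freq_in_simplex)
    have "v_pt x y n \<in> V_set"
      using q success_freq_bounds[of x y n] unfolding v_pt_def V_set_def by blast
    moreover have "v_pt x y n \<notin> S_set"
      using S_set_excess[of "v_pt x y n" j] out q unfolding v_pt_def by (auto simp: excess_decomp simp del: vec_1)
    ultimately have "\<P>(\<omega> in M. Y (Suc n) \<omega> = k \<bar> \<forall>i\<in>{1..n}. Y i \<omega> = y i) = rand_vec (v_pt x y n) $ k"
      using alg n pos unfolding gen_Blackwell_def by blast
    also have "\<dots> = max 0 (?q $ k - ?g) / (\<Sum>l\<in>UNIV. max 0 (?q $ l - ?g))"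
      unfolding v_pt_def by (rule rand_vec_outside[OF q success_freq_bounds out])
    also have "\<dots> = (max 0 (regret x y n k) / real n) / (\<Sum>l\<in>UNIV. max 0 (regret x y n l) / real n)"
    proof -
      have "max 0 (regret x y n l / real n) = max 0 (regret x y n l) / real n" for l
        using n by (auto simp: max_def divide_le_0_iff zero_le_divide_iff)
      then show ?thesis by (simp add: diff)
    qed
    also have "\<dots> = max 0 (regret x y n k) / ?t"
      using n by (simp flip: sum_divide_distrib)
    finally have "prob ?HY / prob ?H = max 0 (regret x y n k) / ?t"
      by (simp add: cond_prob_def)
    then show ?thesis
      using pos t by (simp add: field_simps)
  qed
qed

text \<open>Sums \<open>history_drift\<close> over the finitely many histories, with the next
  outcome for \<open>k\<close>.\<close>

lemma drift_expectation:
  "integrable M (\<lambda>\<omega>. drift x (\<lambda>k. Y k \<omega>) n)" "expectation (\<lambda>\<omega>. drift x (\<lambda>k. Y k \<omega>) n) = 0"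
proof -
  let ?k = "x (Suc n)"
  \<comment> \<open>Extensional functions: the set is finite and each path agrees on
    \<open>{1..n}\<close> with exactly one of its members.\<close>
  define P where "P = PiE {1..n} (\<lambda>_. UNIV :: 'd set)"
  have finP: "finite P" unfolding P_def by (intro finite_PiE) auto
  define H where "H y = {\<omega>\<in>space M. \<forall>i\<in>{1..n}. Y i \<omega> = y i}" for y
  define G where "G y = {\<omega>\<in>space M. Y (Suc n) \<omega> = ?k \<and> (\<forall>i\<in>{1..n}. Y i \<omega> = y i)}" for y
  define r where "r y = max 0 (regret x y n ?k)" for y
  define t where "t y = (\<Sum>l\<in>UNIV. max 0 (regret x y n l))" for y
  have meas: "H y \<in> events" "G y \<in> events" for y
    unfolding H_def G_def using Y_pred
    by (auto intro!: sets.sets_Collect_finite_All sets.sets_Collect_conj)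
  \<comment> \<open>On a fixed history the regrets are constants; only the indicator of a correct
    next prediction stays random.\<close>
  have eq: "drift x (\<lambda>k. Y k \<omega>) n = (\<Sum>y\<in>P. indicator (H y) \<omega> * r y - indicator (G y) \<omega> * t y)"
    if \<omega>: "\<omega> \<in> space M" for \<omega>
  proof -
    define z where "z = restrict (\<lambda>i. Y i \<omega>) {1..n}"
    have zP: "z \<in> P" by (auto simp: z_def P_def)
    have uniq: "y = z" if "y \<in> P" "\<forall>i\<in>{1..n}. Y i \<omega> = y i" for y
      using that unfolding P_def z_def by (intro PiE_ext[of y]) auto
    have zero: "indicator (H y) \<omega> * r y - indicator (G y) \<omega> * t y = 0" if "y \<in> P - {z}" for y
      using that uniq[of y] by (auto simp: H_def G_def indicator_def)
    have "(\<Sum>y\<in>P. indicator (H y) \<omega> * r y - indicator (G y) \<omega> * t y)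
      = indicator (H z) \<omega> * r z - indicator (G z) \<omega> * t z"
      using zero by (subst sum.remove[OF finP zP], subst sum.neutral) auto
    also have "\<dots> = drift x (\<lambda>k. Y k \<omega>) n"
    proof -
      have "regret x z n l = regret x (\<lambda>k. Y k \<omega>) n l" for l
        by (rule regret_cong) (simp add: z_def)
      then show ?thesis
        using \<omega> by (simp add: H_def G_def z_def drift_def r_def t_def indicator_def)
    qed
    finally show ?thesis by simp
  qed
  have int: "integrable M (\<lambda>\<omega>. indicator (H y) \<omega> * r y - indicator (G y) \<omega> * t y)" for y
    using meas by (intro Bochner_Integration.integrable_diff integrable_mult_left)
      (auto simp: less_top[symmetric])
  have val: "expectation (\<lambda>\<omega>. indicator (H y) \<omega> * r y - indicator (G y) \<omega> * t y) = 0" for y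
  proof -
    have "expectation (\<lambda>\<omega>. indicator (H y) \<omega> * r y - indicator (G y) \<omega> * t y)
      = prob (H y) * r y - prob (G y) * t y"
      using meas by (subst Bochner_Integration.integral_diff)
        (auto simp: less_top[symmetric] intro!: integrable_mult_left)
    then show ?thesis
      using history_drift[of n y ?k] by (simp add: H_def G_def r_def t_def)
  qed
  show "integrable M (\<lambda>\<omega>. drift x (\<lambda>k. Y k \<omega>) n)"
    using int by (simp add: eq cong: Bochner_Integration.integrable_cong)
  show "expectation (\<lambda>\<omega>. drift x (\<lambda>k. Y k \<omega>) n) = 0"
    using int val by (simp add: eq Bochner_Integration.integral_sum cong: Bochner_Integration.integral_cong)
qed

text \<open>Regrets are bounded by \<open>n\<close>, hence integrability. In the mean the drift
  drops out of \<open>potential_Suc_le\<close>, leaving \<open>CARD('d)\<close> per step.\<close>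

lemma potential_expectation:
  shows "integrable M (\<lambda>\<omega>. potential x (\<lambda>k. Y k \<omega>) n)"
    and "expectation (\<lambda>\<omega>. potential x (\<lambda>k. Y k \<omega>) n) \<le> real CARD('d) * real n"
proof -
  show int: "integrable M (\<lambda>\<omega>. potential x (\<lambda>k. Y k \<omega>) n)" for n
  proof (rule integrable_const_bound[where B = "\<Sum>l\<in>(UNIV::'d set). (real n)\<^sup>2"])
    show "AE \<omega> in M. norm (potential x (\<lambda>k. Y k \<omega>) n) \<le> (\<Sum>l\<in>(UNIV::'d set). (real n)\<^sup>2)"
    proof (intro AE_I2)
      fix \<omega>
      have "max 0 (regret x (\<lambda>k. Y k \<omega>) n l) \<le> real n" for l
        using abs_regret_le[of x "\<lambda>k. Y k \<omega>" n l] by auto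
      then have "potential x (\<lambda>k. Y k \<omega>) n \<le> (\<Sum>l\<in>(UNIV::'d set). (real n)\<^sup>2)"
        unfolding potential_def by (intro sum_mono power_mono) auto
      moreover have "0 \<le> potential x (\<lambda>k. Y k \<omega>) n"
        unfolding potential_def by (intro sum_nonneg) auto
      ultimately show "norm (potential x (\<lambda>k. Y k \<omega>) n) \<le> (\<Sum>l\<in>(UNIV::'d set). (real n)\<^sup>2)"
        by simp
    qed
  qed (rule potential_measurable)
  show "expectation (\<lambda>\<omega>. potential x (\<lambda>k. Y k \<omega>) n) \<le> real CARD('d) * real n"
  proof (induction n)
    case 0
    show ?case by (simp add: potential_def)
  next
    case (Suc n)
    have "expectation (\<lambda>\<omega>. potential x (\<lambda>k. Y k \<omega>) (Suc n))
      \<le> expectation (\<lambda>\<omega>. potential x (\<lambda>k. Y k \<omega>) n + 2 * drift x (\<lambda>k. Y k \<omega>) n + real CARD('d))"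
      using int drift_expectation by (intro integral_mono potential_Suc_le) auto
    also have "\<dots> = expectation (\<lambda>\<omega>. potential x (\<lambda>k. Y k \<omega>) n) + real CARD('d)"
      using int drift_expectation by (simp add: prob_space)
    finally show ?case
      using Suc by (simp add: algebra_simps)
  qed
qed

section \<open>Almost sure convergence\<close>

text \<open>At time \<open>k\<^sup>2\<close> the term has mean at most
  \<open>CARD('d) / k\<^sup>2\<close>. The series of these nonnegative terms thus has finite mean,
  converges almost surely, and its terms tend to 0.\<close>

lemma AE_potential_squares:
  "AE \<omega> in M. (\<lambda>k. potential x (\<lambda>i. Y i \<omega>) (k\<^sup>2) / (real k) ^ 4) \<longlonglongrightarrow> 0"
proof -
  let ?f = "\<lambda>k \<omega>. potential x (\<lambda>i. Y i \<omega>) (k\<^sup>2) / (real k) ^ 4"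
  have nonneg: "0 \<le> ?f k \<omega>" for k \<omega>
    unfolding potential_def by (intro divide_nonneg_nonneg sum_nonneg) auto
  have meas: "?f k \<in> borel_measurable M" for k
    using potential_measurable by measurable
  have "(\<integral>\<^sup>+\<omega>. ennreal (?f k \<omega>) \<partial>M) \<le> ennreal (real CARD('d) * (1 / (real k)\<^sup>2))" for k
  proof -
    have "(\<integral>\<^sup>+\<omega>. ennreal (?f k \<omega>) \<partial>M) = ennreal (expectation (?f k))"
      using potential_expectation(1) nonneg by (intro nn_integral_eq_integral) auto
    also have "expectation (?f k) \<le> real CARD('d) * real (k\<^sup>2) / (real k) ^ 4"
      using potential_expectation(2)[of "k\<^sup>2"] by (simp add: divide_right_mono)
    \<comment> \<open>For \<open>k = 0\<close> both sides are 0 by division by zero.\<close>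
    also have "\<dots> = real CARD('d) * (1 / (real k)\<^sup>2)"
      by (cases "k = 0") (auto simp: field_simps power2_eq_square power4_eq_xxxx)
    finally show ?thesis by (simp add: ennreal_leI)
  qed
  then have "(\<Sum>k. \<integral>\<^sup>+\<omega>. ennreal (?f k \<omega>) \<partial>M) \<le> (\<Sum>k. ennreal (real CARD('d) * (1 / (real k)\<^sup>2)))"
    by (intro suminf_le) auto
  also have "\<dots> < \<top>"
  proof -
    have "summable (\<lambda>k. real CARD('d) * (1 / (real k)\<^sup>2))"
      using inverse_power_summable[of 2, where 'a = real]
      by (intro summable_mult) (simp add: inverse_eq_divide)
    then show ?thesis by (subst suminf_ennreal2) auto
  qed
  finally have "(\<integral>\<^sup>+\<omega>. (\<Sum>k. ennreal (?f k \<omega>)) \<partial>M) < \<top>"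
    using meas by (subst nn_integral_suminf) auto
  then have "AE \<omega> in M. (\<Sum>k. ennreal (?f k \<omega>)) \<noteq> \<infinity>"
    using meas by (intro nn_integral_PInf_AE) auto
  then show ?thesis
  proof eventually_elim
    case (elim \<omega>)
    then have "summable (\<lambda>k. ?f k \<omega>)"
      using nonneg by (intro summable_suminf_not_top) auto
    then show ?case by (rule summable_LIMSEQ_zero)
  qed
qed

lemma AE_infdist_S_set:
  "AE \<omega> in M. (\<lambda>n. infdist (v_pt x (\<lambda>k. Y k \<omega>) n) S_set) \<longlonglongrightarrow> 0"
  using AE_potential_squares
proof eventually_elim
  case (elim \<omega>)
  let ?y = "\<lambda>k. Y k \<omega>"
  have lim: "(\<lambda>n. max 0 (regret x ?y n l) / real n) \<longlonglongrightarrow> 0" for l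
  proof (rule interpolate_squares)
    show "max 0 (regret x ?y (Suc n) l) \<le> max 0 (regret x ?y n l) + 1" for n
      by (auto simp: regret_Suc)
    \<comment> \<open>Each squared positive regret is one summand of the potential, so the root of
      the normalised potential dominates every coordinate along the squares.\<close>
    have "(\<lambda>k. sqrt (potential x ?y (k\<^sup>2) / (real k) ^ 4)) \<longlonglongrightarrow> 0"
      using tendsto_real_sqrt[OF elim] by simp
    then show "(\<lambda>k. max 0 (regret x ?y (k\<^sup>2) l) / (real k)\<^sup>2) \<longlonglongrightarrow> 0"
    proof (rule tendsto_sandwich[OF eventuallyI eventuallyI tendsto_const, rotated 2])
      fix k
      show "max 0 (regret x ?y (k\<^sup>2) l) / (real k)\<^sup>2 \<le> sqrt (potential x ?y (k\<^sup>2) / (real k) ^ 4)"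
      proof (rule real_le_rsqrt)
        have "(max 0 (regret x ?y (k\<^sup>2) l))\<^sup>2 \<le> potential x ?y (k\<^sup>2)"
          unfolding potential_def by (intro member_le_sum) auto
        then show "(max 0 (regret x ?y (k\<^sup>2) l) / (real k)\<^sup>2)\<^sup>2 \<le> potential x ?y (k\<^sup>2) / (real k) ^ 4"
          by (simp add: power_divide divide_right_mono)
      qed
    qed simp
  qed simp
  have up: "(\<lambda>n. (\<Sum>l\<in>UNIV. max 0 (regret x ?y n l) / real n) * norm (vec 1 :: real^'d)) \<longlonglongrightarrow> 0"
    by (rule tendsto_mult_left_zero[OF tendsto_null_sum[OF lim]])
  show ?case
  proof (rule tendsto_sandwich[OF _ _ tendsto_const up])
    show "\<forall>\<^sub>F n in sequentially. 0 \<le> infdist (v_pt x ?y n) S_set"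
      by (simp add: infdist_nonneg)
    show "\<forall>\<^sub>F n in sequentially. infdist (v_pt x ?y n) S_set
        \<le> (\<Sum>l\<in>UNIV. max 0 (regret x ?y n l) / real n) * norm (vec 1 :: real^'d)"
      using eventually_ge_at_top[of 1] by eventually_elim (rule infdist_v_pt_le)
  qed
qed

end

theorem theorem3p1:
  fixes M :: "'w measure" and x :: "nat \<Rightarrow> 'd::finite" and Y :: "nat \<Rightarrow> 'w \<Rightarrow> 'd"
  assumes "CARD('d) \<ge> 2"
    and "prob_space M"
    and "gen_Blackwell M x Y"
  shows "AE \<omega> in M. (\<lambda>n. infdist (v_pt x (\<lambda>k. Y k \<omega>) n) S_set) \<longlonglongrightarrow> 0"
  using assms(2,3) by (rule AE_infdist_S_set)

end
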